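(* Let $P:\mathbb{R}^n\to\mathbb{R}\cup\{\infty\}$ be a proper closed convex function, and let $f:\mathbb{R}^n\to\mathbb{R}$ be twice continuously differentiable such that, for some $L>0$, all eigenvalues of $\nabla^2 f(x)$ lie in $[-L,L]$ for all $x\in\mathbb{R}^n$. If $f+P$ is coercive and $\gamma\in(0,\frac1L)$, then the forward-backward envelope $F_\gamma$ of $f+P$ is level bounded.
   Context: Norms are Euclidean. The forward-backward envelope is $F_\gamma(x):=\inf_{y}\{f(x)+\langle\nabla f(x),y-x\rangle+\frac{1}{2\gamma}\|y-x\|^2+P(y)\}$, $x\in\mathbb{R}^n$. A proper closed (lower semicontinuous) function $g$ is level bounded if $\{x: g(x)\le r\}$ is bounded for every $r\in\mathbb{R}$, and is coercive if $\liminf_{\|x\|\to\infty} g(x)/\|x\|>0$. *)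

theory Defs
  imports "HOL-Analysis.Analysis"
begin

definition proper_fun :: "('a \<Rightarrow> ereal) \<Rightarrow> bool" where
  "proper_fun g \<longleftrightarrow> (\<forall>x. g x \<noteq> -\<infinity>) \<and> (\<exists>x. g x \<noteq> \<infinity>)"

definition closed_fun :: "('a::topological_space \<Rightarrow> ereal) \<Rightarrow> bool" where
  "closed_fun g \<longleftrightarrow> (\<forall>x. g x \<le> Liminf (at x) g)"

(* In ereal, 0 * \<infinity> = 0, so the degenerate weights u = 0 and v = 0 impose nothing.
   The inequality is the usual convexity only for functions that omit -\<infinity>. *)
definition convex_fun :: "('a::real_vector \<Rightarrow> ereal) \<Rightarrow> bool" where
  "convex_fun g \<longleftrightarrow>
     (\<forall>x y. \<forall>u\<ge>0. \<forall>v\<ge>0. u + v = 1 \<longrightarrow>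
        g (u *\<^sub>R x + v *\<^sub>R y) \<le> ereal u * g x + ereal v * g y)"

definition level_bounded :: "('a::metric_space \<Rightarrow> ereal) \<Rightarrow> bool" where
  "level_bounded g \<longleftrightarrow> (\<forall>r::real. bounded {x. g x \<le> ereal r})"

definition coercive :: "('a::real_normed_vector \<Rightarrow> ereal) \<Rightarrow> bool" where
  "coercive g \<longleftrightarrow> Liminf at_infinity (\<lambda>x. g x / ereal (norm x)) > 0"

(* Unspecified at points where f is not differentiable. *)
definition gradient :: "('a::real_inner \<Rightarrow> real) \<Rightarrow> 'a \<Rightarrow> 'a" where
  "gradient f x = (THE D. GDERIV f x :> D)"

definition hessian :: "(real ^ 'n \<Rightarrow> real) \<Rightarrow> real ^ 'n \<Rightarrow> real ^ 'n ^ 'n" where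
  "hessian f x = jacobian (gradient f) (at x)"

definition twice_continuously_differentiable :: "(real ^ 'n \<Rightarrow> real) \<Rightarrow> bool" where
  "twice_continuously_differentiable f \<longleftrightarrow>
     (\<forall>x. f differentiable (at x)) \<and>
     (\<forall>x. gradient f differentiable (at x)) \<and>
     continuous_on UNIV (hessian f)"

(* Real eigenvalues only; for the symmetric matrix hessian f x these are all of them. *)
definition is_eigenvalue :: "real ^ 'n ^ 'n \<Rightarrow> real \<Rightarrow> bool" where
  "is_eigenvalue A l \<longleftrightarrow> (\<exists>v. v \<noteq> 0 \<and> A *v v = l *\<^sub>R v)"

definition forward_backward_envelope ::
    "('a::real_inner \<Rightarrow> real) \<Rightarrow> ('a \<Rightarrow> ereal) \<Rightarrow> real \<Rightarrow> 'a \<Rightarrow> ereal" where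
  "forward_backward_envelope f P \<gamma> x =
     (INF y. ereal (f x + gradient f x \<bullet> (y - x) + 1 / (2 * \<gamma>) * (norm (y - x))\<^sup>2) + P y)"

lemma gradient_eqI:
  assumes "GDERIV f x :> D"
  shows "gradient f x = D"
  unfolding gradient_def
proof (rule the_equality)
  show "GDERIV f x :> D" by (fact assms)
next
  fix E assume "GDERIV f x :> E"
  with assms have "(\<lambda>h. h \<bullet> E) = (\<lambda>h. h \<bullet> D)"
    unfolding gderiv_def by (metis has_derivative_unique)
  then have "\<forall>h. h \<bullet> E = h \<bullet> D" by metis
  then show "E = D" by (metis vector_eq_rdot inner_commute)
qed

lemma gradient_works:
  fixes f :: "'a::euclidean_space \<Rightarrow> real"
  assumes "f differentiable (at x)"
  shows "GDERIV f x :> gradient f x"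
proof -
  obtain f' where f': "(f has_derivative f') (at x)"
    using assms by (auto simp: differentiable_def)
  then have "linear f'" by (rule has_derivative_linear)
  then have "f' = (\<lambda>h. h \<bullet> adjoint f' 1)"
    by (simp add: adjoint_works fun_eq_iff)
  with f' have "GDERIV f x :> adjoint f' 1"
    unfolding gderiv_def by metis
  then show ?thesis using gradient_eqI by metis
qed

end

theory Submission
  imports Defs
begin

text \<open>
  Since the Hessian is symmetric with eigenvalues at most \<open>L\<close>, the descent lemma gives
  \<open>f y \<le> f x + \<nabla>f x \<bullet> (y - x) + L/2 \<parallel>y - x\<parallel>\<^sup>2\<close>, so with \<open>a = (1/\<gamma> - L)/2 > 0\<close> the envelope at \<open>x\<close>
  is at least the infimum over \<open>y\<close> of \<open>(f + P) y + a \<parallel>y - x\<parallel>\<^sup>2\<close>. Coercivity together with lower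
  semicontinuity gives \<open>(f + P) y \<ge> c \<parallel>y\<parallel> - M\<close> for all \<open>y\<close>, and completing the square bounds the
  envelope below by \<open>c \<parallel>x\<parallel> - c\<^sup>2/(4a) - M\<close>.
\<close>

section \<open>Symmetry of the second derivative\<close>

text \<open>
  The second difference is symmetric in \<open>u\<close> and \<open>v\<close>, so this estimate yields the symmetry of the
  second derivative without assuming it continuous.
\<close>

lemma second_difference_estimate:
  fixes f :: "'a::real_inner \<Rightarrow> real"
  assumes f: "\<And>x. GDERIV f x :> g x" and g: "(g has_derivative g') (at x)" and "e > 0"
  shows "\<exists>d>0. \<forall>t. 0 < t \<and> t < d \<longrightarrow>
    \<bar>f (x + t *\<^sub>R u + t *\<^sub>R v) - f (x + t *\<^sub>R u) - f (x + t *\<^sub>R v) + f x - t\<^sup>2 * (v \<bullet> g' u)\<bar>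
      \<le> 2 * e * (norm u + norm v)\<^sup>2 * t\<^sup>2"
proof -
  define N where "N = norm u + norm v"
  have N: "N \<ge> 0" "norm v \<le> N" unfolding N_def by auto
  interpret g': bounded_linear g' using g by (rule has_derivative_bounded_linear)
  obtain d where d: "d > 0"
    "\<And>y. norm (y - x) < d \<Longrightarrow> norm (g y - g x - g' (y - x)) \<le> e * norm (y - x)"
    using g \<open>e > 0\<close> unfolding has_derivative_at_alt by blast
  \<comment> \<open>The threshold \<open>d / (N + 1)\<close> gives \<open>t * N < d\<close>, which
    keeps both points at which \<open>g\<close> is linearised below within distance \<open>d\<close>
    of \<open>x\<close>; the \<open>+ 1\<close> covers \<open>N = 0\<close>.\<close>
  have "\<bar>f (x + t *\<^sub>R u + t *\<^sub>R v) - f (x + t *\<^sub>R u) - f (x + t *\<^sub>R v) + f x - t\<^sup>2 * (v \<bullet> g' u)\<bar>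
      \<le> 2 * e * N\<^sup>2 * t\<^sup>2" if t: "0 < t" "t < d / (N + 1)" for t
  proof -
    \<comment> \<open>The second difference is \<open>\<phi> t - \<phi> 0\<close>, so one
      application of the mean value theorem turns it into a difference of gradients.\<close>
    define \<phi> where "\<phi> s = f (x + t *\<^sub>R u + s *\<^sub>R v) - f (x + s *\<^sub>R v)" for s
    define D where "D s = v \<bullet> (g (x + t *\<^sub>R u + s *\<^sub>R v) - g (x + s *\<^sub>R v))" for s
    have \<phi>': "(\<phi> has_real_derivative D s) (at s)" for s
      unfolding \<phi>_def D_def has_field_derivative_def
      by (auto intro!: derivative_eq_intros has_derivative_compose[OF _ f[unfolded gderiv_def]]
        simp: algebra_simps)
    obtain s where s: "0 < s" "s < t" "\<phi> t - \<phi> 0 = (t - 0) * D s"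
      using MVT2[OF t(1), of \<phi> D] \<phi>' by auto
    define h where "h = t *\<^sub>R u + s *\<^sub>R v"
    have small: "t * N < d"
    proof -
      have "t * N \<le> t * (N + 1)" using t by (simp add: algebra_simps)
      also have "\<dots> < d" using t N by (simp add: pos_less_divide_eq)
      finally show ?thesis .
    qed
    have h: "norm h \<le> t * N"
    proof -
      have "norm h \<le> t * norm u + s * norm v"
        unfolding h_def using norm_triangle_ineq[of "t *\<^sub>R u" "s *\<^sub>R v"] s t by simp
      also have "\<dots> \<le> t * N" unfolding N_def using s by (simp add: distrib_left mult_right_mono)
      finally show ?thesis .
    qed
    have sv: "norm (s *\<^sub>R v) \<le> t * N"
      using s N by (auto intro!: mult_mono)
    have 1: "norm (g (x + h) - g x - g' h) \<le> e * (t * N)"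
      using order_trans[OF d(2)[of "x + h"]] h small mult_left_mono[OF h, of e] \<open>e > 0\<close> by simp
    have 2: "norm (g (x + s *\<^sub>R v) - g x - g' (s *\<^sub>R v)) \<le> e * (t * N)"
      using order_trans[OF d(2)[of "x + s *\<^sub>R v"]] sv small mult_left_mono[OF sv, of e] \<open>e > 0\<close> by simp
    \<comment> \<open>Both gradients are linearised at \<open>x\<close>. Since \<open>h\<close> and
      \<open>s *\<^sub>R v\<close> differ by \<open>t *\<^sub>R u\<close>, the linear parts leave
      \<open>t *\<^sub>R g' u\<close> and the unknown \<open>s\<close> drops out.\<close>
    have "norm (g (x + h) - g (x + s *\<^sub>R v) - t *\<^sub>R g' u) \<le> 2 * (e * (t * N))"
      using norm_triangle_ineq4[of "g (x + h) - g x - g' h" "g (x + s *\<^sub>R v) - g x - g' (s *\<^sub>R v)"] 1 2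
      unfolding h_def g'.add g'.scaleR by (simp add: algebra_simps)
    then have "\<bar>v \<bullet> (g (x + h) - g (x + s *\<^sub>R v) - t *\<^sub>R g' u)\<bar> \<le> N * (2 * (e * (t * N)))"
      using N by (intro order_trans[OF Cauchy_Schwarz_ineq2] mult_mono) auto
    then have "\<bar>t * (v \<bullet> (g (x + h) - g (x + s *\<^sub>R v) - t *\<^sub>R g' u))\<bar> \<le> t * (N * (2 * (e * (t * N))))"
      using t unfolding abs_mult by (intro mult_mono) auto
    also have "t * (v \<bullet> (g (x + h) - g (x + s *\<^sub>R v) - t *\<^sub>R g' u)) = \<phi> t - \<phi> 0 - t\<^sup>2 * (v \<bullet> g' u)"
      unfolding s(3) D_def h_def by (simp add: algebra_simps power2_eq_square)
    finally show ?thesis unfolding \<phi>_def by (simp add: algebra_simps power2_eq_square)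
  qed
  moreover have "d / (N + 1) > 0" using d N by simp
  ultimately show ?thesis unfolding N_def by blast
qed

theorem second_derivative_symmetric:
  fixes f :: "'a::real_inner \<Rightarrow> real"
  assumes f: "\<And>x. GDERIV f x :> g x" and g: "(g has_derivative g') (at x)"
  shows "v \<bullet> g' u = u \<bullet> g' v"
proof -
  define K where "K = 4 * (norm u + norm v)\<^sup>2"
  have bound: "\<bar>v \<bullet> g' u - u \<bullet> g' v\<bar> \<le> e * K" if e: "e > 0" for e
  proof -
    obtain d1 where d1: "d1 > 0" "\<And>t. 0 < t \<Longrightarrow> t < d1 \<Longrightarrow>
      \<bar>f (x + t *\<^sub>R u + t *\<^sub>R v) - f (x + t *\<^sub>R u) - f (x + t *\<^sub>R v) + f x - t\<^sup>2 * (v \<bullet> g' u)\<bar>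
        \<le> 2 * e * (norm u + norm v)\<^sup>2 * t\<^sup>2"
      using second_difference_estimate[OF f g e, of u v] by blast
    obtain d2 where d2: "d2 > 0" "\<And>t. 0 < t \<Longrightarrow> t < d2 \<Longrightarrow>
      \<bar>f (x + t *\<^sub>R v + t *\<^sub>R u) - f (x + t *\<^sub>R v) - f (x + t *\<^sub>R u) + f x - t\<^sup>2 * (u \<bullet> g' v)\<bar>
        \<le> 2 * e * (norm v + norm u)\<^sup>2 * t\<^sup>2"
      using second_difference_estimate[OF f g e, of v u] by blast
    define t where "t = min d1 d2 / 2"
    have t: "0 < t" "t < d1" "t < d2" unfolding t_def using d1(1) d2(1) by auto
    have sw: "x + t *\<^sub>R v + t *\<^sub>R u = x + t *\<^sub>R u + t *\<^sub>R v" "norm v + norm u = norm u + norm v"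
      by simp_all
    have "\<bar>t\<^sup>2 * (v \<bullet> g' u) - t\<^sup>2 * (u \<bullet> g' v)\<bar> \<le> 4 * e * (norm u + norm v)\<^sup>2 * t\<^sup>2"
      using d1(2)[OF t(1,2)] d2(2)[OF t(1,3)] unfolding sw by linarith
    then have "t\<^sup>2 * \<bar>v \<bullet> g' u - u \<bullet> g' v\<bar> \<le> t\<^sup>2 * (e * K)"
      unfolding K_def right_diff_distrib[symmetric] abs_mult by (simp add: mult_ac)
    then show ?thesis using t by simp
  qed
  have "\<bar>v \<bullet> g' u - u \<bullet> g' v\<bar> \<le> 0 + e" if "e > 0" for e
  proof -
    have K: "K \<ge> 0" unfolding K_def by simp
    \<comment> \<open>The divisor is \<open>K + 1\<close> because \<open>K\<close> vanishes when
      \<open>u\<close> and \<open>v\<close> are both zero.\<close>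
    have "\<bar>v \<bullet> g' u - u \<bullet> g' v\<bar> \<le> e / (K + 1) * K" using that K by (intro bound) simp
    also have "\<dots> \<le> e" using that K by (simp add: divide_simps algebra_simps)
    finally show ?thesis by simp
  qed
  then have "\<bar>v \<bullet> g' u - u \<bullet> g' v\<bar> \<le> 0" by (rule field_le_epsilon)
  then show ?thesis by simp
qed

section \<open>Upper curvature bounds: Rayleigh quotient and descent lemma\<close>

text \<open>The form attains a maximum \<open>m\<close> on the compact unit sphere. By symmetry the
  maximizer is an eigenvector with eigenvalue \<open>m\<close>, so \<open>m \<le> L\<close>, and
  homogeneity extends the bound to all vectors.\<close>

lemma quadratic_form_le_eigenvalue_bound:
  fixes A :: "real ^ 'n ^ 'n"
  assumes sym: "\<And>u v. v \<bullet> (A *v u) = u \<bullet> (A *v v)"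
    and eig: "\<And>l. is_eigenvalue A l \<Longrightarrow> l \<le> L"
  shows "v \<bullet> (A *v v) \<le> L * (norm v)\<^sup>2"
proof -
  have "\<exists>z\<in>sphere 0 1. \<forall>w\<in>sphere 0 1. w \<bullet> (A *v w) \<le> z \<bullet> (A *v z)"
    by (rule continuous_attains_sup)
      (auto intro: continuous_on_inner[OF continuous_on_id
        linear_continuous_on[OF matrix_vector_mul_bounded_linear]])
  then obtain z where z: "norm z = 1" "\<And>w. norm w = 1 \<Longrightarrow> w \<bullet> (A *v w) \<le> z \<bullet> (A *v z)"
    by auto
  define m where "m = z \<bullet> (A *v z)"
  have form: "w \<bullet> (A *v w) \<le> m * (norm w)\<^sup>2" for w
  proof (cases "w = 0")
    case False
    have w: "w = norm w *\<^sub>R sgn w" using False by (simp add: sgn_div_norm)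
    have "w \<bullet> (A *v w) = (norm w)\<^sup>2 * (sgn w \<bullet> (A *v sgn w))"
      by (subst (1 2) w) (simp add: matrix_vector_mult_scaleR power2_eq_square del: sgn_div_norm)
    also have "\<dots> \<le> (norm w)\<^sup>2 * m"
      unfolding m_def using z(2)[of "sgn w"] False by (intro mult_left_mono) (auto simp: norm_sgn)
    finally show ?thesis by (simp add: mult_ac)
  qed simp
  txt \<open>The residual \<open>w\<close> is an ascent direction of the Rayleigh quotient at its maximizer \<open>z\<close>.\<close>
  define w where "w = A *v z - m *\<^sub>R z"
  define q where "q = m * (norm w)\<^sup>2 - w \<bullet> (A *v w)"
  have q: "q \<ge> 0" unfolding q_def using form[of w] by simp
  \<comment> \<open>Apply \<open>form\<close> at \<open>z + t *\<^sub>R w\<close>: the constant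
    terms cancel, and a first-order gain is left against a second-order loss.\<close>
  have perturb: "2 * t * (w \<bullet> w) \<le> t\<^sup>2 * q" for t
  proof -
    have form_at: "(z + t *\<^sub>R w) \<bullet> (A *v (z + t *\<^sub>R w)) = m + 2 * t * (w \<bullet> (A *v z)) + t\<^sup>2 * (w \<bullet> (A *v w))"
      using sym[of z w] unfolding m_def
      by (simp add: matrix_vector_right_distrib matrix_vector_mult_scaleR inner_add_left inner_add_right
        algebra_simps power2_eq_square)
    have norm_at: "(norm (z + t *\<^sub>R w))\<^sup>2 = 1 + 2 * t * (w \<bullet> z) + t\<^sup>2 * (norm w)\<^sup>2"
    proof -
      have "z \<bullet> z = 1" using z(1) by (simp add: norm_eq_1)
      then show ?thesis
        unfolding power2_norm_eq_inner
        by (simp add: inner_add_left inner_add_right inner_commute algebra_simps power2_eq_square)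
    qed
    have ww: "w \<bullet> w = w \<bullet> (A *v z) - m * (w \<bullet> z)"
      by (subst (2) w_def) (simp add: inner_diff_right)
    show ?thesis using form[of "z + t *\<^sub>R w"]
      unfolding form_at norm_at q_def ww by (simp add: algebra_simps)
  qed
  have "w = 0"
  proof (rule ccontr)
    assume "w \<noteq> 0"
    then have W: "w \<bullet> w > 0" by simp
    \<comment> \<open>Small enough that \<open>t * q \<le> w \<bullet> w\<close>, which contradicts
      \<open>perturb\<close>; the \<open>+ 1\<close> covers \<open>q = 0\<close>.\<close>
    define t where "t = (w \<bullet> w) / (q + 1)"
    have t: "t > 0" unfolding t_def using W q by simp
    have "t * (2 * (w \<bullet> w)) \<le> t * (t * q)" using perturb[of t] by (simp add: power2_eq_square mult_ac)
    then have "2 * (w \<bullet> w) \<le> t * q" using t by simp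
    also have "\<dots> \<le> w \<bullet> w" unfolding t_def using W q by (simp add: divide_simps algebra_simps)
    finally show False using W by simp
  qed
  then have "A *v z = m *\<^sub>R z" unfolding w_def by simp
  then have "m \<le> L" using z(1) by (intro eig) (auto simp: is_eigenvalue_def intro!: exI[of _ z])
  then have "m * (norm v)\<^sup>2 \<le> L * (norm v)\<^sup>2" by (simp add: mult_right_mono)
  then show ?thesis using form[of v] by linarith
qed

text \<open>Taylor's formula of order two along the segment from \<open>x\<close> to
  \<open>y\<close>, with Lagrange remainder; \<open>le\<close> bounds the remainder.\<close>

lemma descent_lemma:
  fixes f :: "'a::real_inner \<Rightarrow> real"
  assumes f: "\<And>x. GDERIV f x :> g x" and g: "\<And>x. (g has_derivative g' x) (at x)"
    and le: "\<And>x v. v \<bullet> g' x v \<le> L * (norm v)\<^sup>2"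
  shows "f y \<le> f x + g x \<bullet> (y - x) + L / 2 * (norm (y - x))\<^sup>2"
proof -
  define v where "v = y - x"
  \<comment> \<open>\<open>d m\<close> is the derivative of order \<open>m\<close> of
    \<open>f\<close> along the segment, in the indexed form that \<open>Maclaurin\<close> expects;
    only \<open>m \<le> 2\<close> matters.\<close>
  define d :: "nat \<Rightarrow> real \<Rightarrow> real" where "d m t =
    (if m = 0 then f (x + t *\<^sub>R v) else if m = 1 then v \<bullet> g (x + t *\<^sub>R v)
     else v \<bullet> g' (x + t *\<^sub>R v) v)" for m t
  have lin: "g' x (t *\<^sub>R v) = t *\<^sub>R g' x v" for x t
    using has_derivative_linear[OF g] by (rule linear_scale)
  have "(d 0 has_real_derivative d 1 t) (at t)" for t
    unfolding d_def has_field_derivative_def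
    by (simp, rule has_derivative_eq_rhs[OF has_derivative_compose[OF _ f[unfolded gderiv_def]]])
      (auto intro!: derivative_eq_intros)
  moreover have "(d 1 has_real_derivative d 2 t) (at t)" for t
    unfolding d_def has_field_derivative_def
    by (auto intro!: derivative_eq_intros has_derivative_compose[OF _ g] simp: lin fun_eq_iff)
  ultimately have "\<forall>m t. m < 2 \<and> 0 \<le> t \<and> t \<le> 1 \<longrightarrow> DERIV (d m) t :> d (Suc m) t"
    by (auto simp: numeral_2_eq_2 less_Suc_eq)
  then obtain t where "d 0 1 = (\<Sum>m<2. (d m 0 / fact m) * 1 ^ m) + (d 2 t / fact 2) * 1 ^ 2"
    using Maclaurin[of 1 2 d "d 0"] by auto
  then have "f y = f x + g x \<bullet> v + (v \<bullet> g' (x + t *\<^sub>R v) v) / 2"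
    by (simp add: d_def v_def inner_commute lessThan_nat_numeral numeral_2_eq_2)
  then show ?thesis using le[of v "x + t *\<^sub>R v"] unfolding v_def by simp
qed

section \<open>Lower semicontinuity and coercive growth\<close>

text \<open>Lower semicontinuity gives each point a neighbourhood with a finite lower bound, and a
  finite subcover makes the bound uniform.\<close>

lemma closed_fun_bounded_below_on_compact:
  fixes P :: "'a::topological_space \<Rightarrow> ereal"
  assumes P: "closed_fun P" "\<And>x. P x \<noteq> -\<infinity>" and S: "compact S"
  shows "\<exists>m::real. \<forall>x\<in>S. ereal m \<le> P x"
proof -
  have "\<exists>U m. open U \<and> x \<in> U \<and> (\<forall>y\<in>U. ereal m \<le> P y)" for x
  proof -
    \<comment> \<open>The limit inferior over \<open>at x\<close> ignores the value at
      \<open>x\<close>, so \<open>m\<close> is chosen below \<open>P x\<close> itself and serves at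
      the centre as well as around it.\<close>
    obtain m where m: "ereal m < P x"
      using P(2)[of x] ereal_dense2[of "-\<infinity>" "P x"] by auto
    then have "ereal m < Liminf (at x) P"
      using P(1) unfolding closed_fun_def by (metis less_le_trans)
    then have "eventually (\<lambda>y. ereal m < P y) (at x)" by (rule less_LiminfD)
    then obtain U where "open U" "x \<in> U" "\<forall>y\<in>U. y \<noteq> x \<longrightarrow> ereal m < P y"
      unfolding eventually_at_topological by auto
    then show ?thesis using m by (intro exI[of _ U] exI[of _ m]) (metis less_imp_le)
  qed
  then obtain U m where U: "\<And>x. open (U x)" "\<And>x. x \<in> U x" "\<And>x y. y \<in> U x \<Longrightarrow> ereal (m x) \<le> P y"
    by metis
  obtain T where T: "finite T" "S \<subseteq> (\<Union>x\<in>T. U x)"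
    using compactE_image[OF S, of S U] U(1,2) by (metis UN_I subsetI)
  \<comment> \<open>Inserting \<open>0\<close> keeps the minimum meaningful when \<open>T\<close> is
    empty.\<close>
  have "ereal (Min (insert 0 (m ` T))) \<le> P y" if y: "y \<in> S" for y
  proof -
    obtain x where x: "x \<in> T" "y \<in> U x" using T y by auto
    then have "ereal (Min (insert 0 (m ` T))) \<le> ereal (m x)" using T by (simp add: Min_le_iff)
    then show ?thesis using U(3)[OF x(2)] by (rule order_trans)
  qed
  then show ?thesis by blast
qed

text \<open>Coercivity gives linear growth outside a ball; inside it, compactness bounds
  \<open>f\<close> and \<open>P\<close> below, and the constant \<open>M\<close> absorbs the
  difference.\<close>

lemma coercive_linear_lower_bound:
  fixes P :: "'a::euclidean_space \<Rightarrow> ereal"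
  assumes P: "closed_fun P" "\<And>x. P x \<noteq> -\<infinity>" and f: "continuous_on UNIV f"
    and co: "coercive (\<lambda>x. ereal (f x) + P x)"
  shows "\<exists>c>0. \<exists>M::real. \<forall>x. ereal (c * norm x - M) \<le> ereal (f x) + P x"
proof -
  obtain c where c: "c > 0" "ereal c < Liminf at_infinity (\<lambda>x. (ereal (f x) + P x) / ereal (norm x))"
    using ereal_dense2[OF co[unfolded coercive_def]] by auto
  then obtain b where b: "\<And>x. norm x \<ge> b \<Longrightarrow> ereal c < (ereal (f x) + P x) / ereal (norm x)"
    using less_LiminfD[OF c(2)] unfolding eventually_at_infinity by auto
  \<comment> \<open>\<open>R \<ge> 1\<close> makes the norm positive, so the quotient in
    \<open>b\<close> can be cleared.\<close>
  define R where "R = max b 1"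
  have far: "ereal (c * norm x) \<le> ereal (f x) + P x" if x: "norm x \<ge> R" for x
    using b[of x] x unfolding R_def
    by (cases "P x") (auto simp: pos_less_divide_eq split: if_splits)
  obtain p where p: "\<And>x. norm x \<le> R \<Longrightarrow> ereal p \<le> P x"
    using closed_fun_bounded_below_on_compact[OF P, of "cball 0 R"]
    by (metis compact_cball mem_cball_0)
  have "bounded (f ` cball 0 R)"
    by (intro compact_imp_bounded compact_continuous_image continuous_on_subset[OF f]) auto
  then obtain B where B: "\<And>x. norm x \<le> R \<Longrightarrow> \<bar>f x\<bar> \<le> B"
    unfolding bounded_iff by (metis imageI mem_cball_0 real_norm_def)
  \<comment> \<open>Inside the ball \<open>c * R - M \<le> p - B\<close> is required; outside it
    \<open>M \<ge> 0\<close> suffices.\<close>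
  define M where "M = max 0 (c * R + B - p)"
  have "ereal (c * norm x - M) \<le> ereal (f x) + P x" for x
  proof (cases "norm x \<ge> R")
    case True
    have "ereal (c * norm x - M) \<le> ereal (c * norm x)" unfolding M_def by simp
    then show ?thesis using far[OF True] by (rule order_trans)
  next
    case False
    then have x: "norm x \<le> R" by simp
    have "c * norm x - M \<le> f x + p"
      using B[OF x] mult_left_mono[OF x, of c] c(1) unfolding M_def by linarith
    then have "ereal (c * norm x - M) \<le> ereal (f x) + ereal p" by simp
    also have "\<dots> \<le> ereal (f x) + P x" using p[OF x] by (rule add_left_mono)
    finally show ?thesis .
  qed
  then show ?thesis using c(1) by blast
qed

section \<open>Growth of the envelope\<close>

text \<open>Replacing \<open>y\<close> by \<open>x\<close> in the linear term costs at most
  \<open>c * norm (y - x)\<close>, which the quadratic absorbs up to a constant. This carries growth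
  in the minimization variable over to the base point.\<close>

lemma linear_plus_quadratic_lower_bound:
  fixes x y :: "'a::real_normed_vector"
  assumes "a > 0" "c > 0"
  shows "c * norm x - c\<^sup>2 / (4 * a) \<le> c * norm y + a * (norm (y - x))\<^sup>2"
proof -
  have "c * norm x \<le> c * (norm y + norm (y - x))"
    using norm_triangle_sub[of x y] assms by (intro mult_left_mono) (auto simp: norm_minus_commute)
  moreover have "c * norm (y - x) \<le> a * (norm (y - x))\<^sup>2 + c\<^sup>2 / (4 * a)"
  proof -
    have "0 \<le> (2 * a * norm (y - x) - c)\<^sup>2 / (4 * a)" using assms by simp
    also have "\<dots> = a * (norm (y - x))\<^sup>2 + c\<^sup>2 / (4 * a) - c * norm (y - x)"
      using assms by (simp add: field_simps power2_eq_square)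
    finally show ?thesis by simp
  qed
  ultimately show ?thesis by (simp add: distrib_left)
qed

theorem theorem3p1:
  fixes P :: "real ^ 'n \<Rightarrow> ereal"
    and f :: "real ^ 'n \<Rightarrow> real"
    and L \<gamma> :: real
  assumes "proper_fun P" and "closed_fun P" and "convex_fun P"
    and "twice_continuously_differentiable f"
    and "L > 0"
    and "\<And>x l. is_eigenvalue (hessian f x) l \<Longrightarrow> l \<in> {-L..L}"
    and "coercive (\<lambda>x. ereal (f x) + P x)"
    and "\<gamma> \<in> {0<..<1 / L}"
  shows "level_bounded (forward_backward_envelope f P \<gamma>)"
proof -
  note C2 = assms(4)[unfolded twice_continuously_differentiable_def]
  have f: "GDERIV f x :> gradient f x" for x
    using C2 by (blast intro: gradient_works)
  have g: "(gradient f has_derivative (\<lambda>h. hessian f x *v h)) (at x)" for x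
    using C2 unfolding hessian_def jacobian_works[symmetric] by blast
  have "v \<bullet> (hessian f x *v v) \<le> L * (norm v)\<^sup>2" for x v
    using assms(6) by (intro quadratic_form_le_eigenvalue_bound second_derivative_symmetric[OF f g]) auto
  note descent = descent_lemma[OF f g this]
  have "continuous_on UNIV f"
    using C2 by (simp add: continuous_at_imp_continuous_on differentiable_imp_continuous_within)
  moreover have "P x \<noteq> -\<infinity>" for x using assms(1) unfolding proper_fun_def by blast
  ultimately obtain c M where c: "c > 0" and M: "\<And>x. ereal (c * norm x - M) \<le> ereal (f x) + P x"
    using coercive_linear_lower_bound[OF assms(2) _ _ assms(7)] by blast
  define a where "a = 1 / (2 * \<gamma>) - L / 2"
  have a: "a > 0" unfolding a_def using assms(5,8) by (simp add: field_simps)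
  have lower: "ereal (c * norm x - c\<^sup>2 / (4 * a) - M) \<le> forward_backward_envelope f P \<gamma> x" for x
    unfolding forward_backward_envelope_def
  proof (rule INF_greatest)
    fix y
    let ?m = "f x + gradient f x \<bullet> (y - x) + 1 / (2 * \<gamma>) * (norm (y - x))\<^sup>2"
    have "c * norm x - c\<^sup>2 / (4 * a) - M \<le> a * (norm (y - x))\<^sup>2 + (c * norm y - M)"
      using linear_plus_quadratic_lower_bound[OF a c, of x y] by linarith
    then have "ereal (c * norm x - c\<^sup>2 / (4 * a) - M) \<le> ereal (a * (norm (y - x))\<^sup>2) + ereal (c * norm y - M)"
      by simp
    also have "\<dots> \<le> ereal (a * (norm (y - x))\<^sup>2) + (ereal (f y) + P y)"
      using M by (rule add_left_mono)
    also have "\<dots> = ereal (a * (norm (y - x))\<^sup>2 + f y) + P y"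
      by (simp add: add.assoc[symmetric])
    \<comment> \<open>The descent lemma replaces \<open>f y\<close> by its expansion at
      \<open>x\<close>; its term \<open>L / 2\<close> and \<open>a\<close> add up to exactly
      \<open>1 / (2 * \<gamma>)\<close>.\<close>
    also have "\<dots> \<le> ereal ?m + P y"
      using descent[of y x] unfolding a_def by (intro add_right_mono) (simp add: algebra_simps)
    finally show "ereal (c * norm x - c\<^sup>2 / (4 * a) - M) \<le> ereal ?m + P y" .
  qed
  show ?thesis
    unfolding level_bounded_def
  proof
    fix r :: real
    have "norm x \<le> (r + M + c\<^sup>2 / (4 * a)) / c" if "forward_backward_envelope f P \<gamma> x \<le> ereal r" for x
    proof -
      have "c * norm x - c\<^sup>2 / (4 * a) - M \<le> r"
        using order_trans[OF lower that] by simp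
      then show ?thesis using c by (simp add: pos_le_divide_eq mult.commute)
    qed
    then show "bounded {x. forward_backward_envelope f P \<gamma> x \<le> ereal r}"
      unfolding bounded_iff by blast
  qed
qed

end
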